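(* Let $h$ be a positive even integer and let $\mathcal{A}=\{0\le a_1<a_2<\cdots\}$ be an infinite $B_h$-set. Then $$\limsup_{n\to\infty}\frac{a_n}{n^h\log n}\ge\frac{\log 2}{\pi}\cdot\frac{h\,\Gamma(1+\tfrac1h)^{h}}{\Gamma(1+\tfrac h2)^2}.$$
   Context: A set $\mathcal{A}$ of nonnegative integers is a $B_h$-set if the sums $a_1+\cdots+a_h$ with $a_1\le\cdots\le a_h$ and all $a_i\in\mathcal{A}$ are distinct (i.e., distinct nondecreasing $h$-tuples of elements of $\mathcal{A}$ have distinct sums). Here $a_1<a_2<\cdots$ enumerates the elements of $\mathcal{A}$ in increasing order. $\log$ is the natural logarithm and $\Gamma$ is the Gamma function. *)

theory Defs
  imports "HOL-Analysis.Analysis"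
begin

definition Bh_set :: "nat \<Rightarrow> nat set \<Rightarrow> bool" where
  "Bh_set h A \<longleftrightarrow> inj_on sum_list {xs. length xs = h \<and> sorted xs \<and> set xs \<subseteq> A}"

text \<open>The elements of \<open>A\<close> in increasing order are indexed from 1, whereas
  \<^const>\<open>enumerate\<close> starts at 0. The value at index 0 is irrelevant.\<close>
definition nth_elem :: "nat set \<Rightarrow> nat \<Rightarrow> nat" where
  "nth_elem A n = enumerate A (n - 1)"

end

theory Submission
  imports Defs "HOL-Combinatorics.Multiset_Permutations" "HOL-Real_Asymp.Real_Asymp"
begin

text \<open>
  Write \<open>h = 2 k\<close> and \<open>a\<^sub>n\<close> for the \<open>n\<close>-th element of \<open>A\<close>, and suppose that \<open>a\<^sub>n \<le> c n\<^sup>h ln n\<close>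
  for all large \<open>n\<close>. The claim is that \<open>c\<close> is at least the stated constant. The proof is a weighted
  form of the argument of Erdos for Sidon sets, which counts the \<open>k\<close>-fold sums of \<open>A\<close> in short
  intervals.

  Let \<open>F\<close> be a finite subset of \<open>A\<close>, and let \<open>R(t)\<close> be the number of \<open>k\<close>-tuples over \<open>F\<close> whose sum
  lies in \<open>(t - N, t]\<close>. The energy \<open>\<Sum>\<^sub>t R(t)\<^sup>2\<close> counts pairs of tuples with close sums. Two tuples
  without a common entry are determined by the difference of their sums, up to the order of the
  entries, because \<open>A\<close> is a \<open>B\<^sub>2\<^sub>k\<close>-set; such pairs contribute at most \<open>(k! N)\<^sup>2\<close>. Pairs with a common
  entry contribute at most \<open>k\<^sup>2 |F|\<close> times the energy of the \<open>(k-1)\<close>-fold sums, and since the energies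
  are log-convex in the number of summands, this is negligible as soon as \<open>|F|\<^sup>k = o(N)\<close>
  (lemma \<open>energy_le\<close>).

  For the opposite bound, put \<open>f(s) = \<Sum>\<^bsub>a \<in> F\<^esub> e\<^bsup>-sa\<^esup>\<close>, so that \<open>f(s)\<^sup>k\<close> is the sum of \<open>e\<^bsup>-sb\<^esup>\<close> over the
  sums \<open>b\<close> of \<open>k\<close>-tuples. The upper bound on \<open>a\<^sub>n\<close> gives
  \<open>f(1/m) \<ge> (1 - o(1)) \<Gamma>(1 + 1/h) (h m / (c ln m))\<^bsup>1/h\<^esup>\<close> (lemma \<open>sum_exp_sequence_asymp\<close>). Test the
  counting function \<open>R\<close> against the weight \<open>W(t) = \<Sum>\<^sub>m v\<^sub>m e\<^bsup>-t/m\<^esup> / m\<close> with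
  \<open>v\<^sub>m = (m ln m)\<^bsup>-1/2\<^esup>\<close>, where \<open>m\<close> runs from about \<open>N\<close> to about \<open>N\<^sup>2\<close>. By the Cauchy-Schwarz
  inequality, \<open>(\<Sum>\<^sub>t R(t) W(t))\<^sup>2\<close> is at most the energy times \<open>\<Sum>\<^sub>t W(t)\<^sup>2\<close>, and Hilbert's inequality
  bounds the latter by \<open>\<pi> S\<close> with \<open>S = \<Sum>\<^sub>m 1 / (m ln m)\<close> (lemma \<open>exp_sums_le_energy\<close>). On the other
  side, \<open>\<Sum>\<^sub>t R(t) W(t)\<close> is at least about \<open>N \<Gamma>(1 + 1/h)\<^sup>k (h/c)\<^bsup>1/2\<^esup> S\<close>. Hence
  \<open>\<Gamma>(1 + 1/h)\<^sup>h (h/c) S \<le> (1 + o(1)) \<pi> k!\<^sup>2\<close>, and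
  \<open>S\<close> tends to \<open>ln (ln N\<^sup>2 / ln N) = ln 2\<close>, which is where the factor \<open>ln 2\<close> comes from.
\<close>

section \<open>Overlaps of windows\<close>

text \<open>The number of integers common to two windows of length \<open>N\<close> whose left ends differ by \<open>d\<close>.\<close>

definition overlap :: "nat \<Rightarrow> int \<Rightarrow> real" where
  "overlap N d = max 0 (real N - \<bar>real_of_int d\<bar>)"

text \<open>The number of indices \<open>i\<close> for which the window of length \<open>N\<close> that starts at \<open>p i\<close> contains \<open>t\<close>.\<close>
definition window :: "nat \<Rightarrow> 'i set \<Rightarrow> ('i \<Rightarrow> int) \<Rightarrow> int \<Rightarrow> real" where
  "window N I p t = (\<Sum>i\<in>I. of_bool (t \<in> {p i..<p i + int N}))"

lemma overlap_nonneg: "overlap N d \<ge> 0"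
  by (simp add: overlap_def)

lemma overlap_eq_sum:
  assumes "finite S" and "{x..<x + int N} \<subseteq> S"
  shows "overlap N (x - y) =
    (\<Sum>t\<in>S. of_bool (t \<in> {x..<x + int N}) * of_bool (t \<in> {y..<y + int N}))"
proof -
  have "(\<Sum>t\<in>S. of_bool (t \<in> {x..<x + int N}) * of_bool (t \<in> {y..<y + int N}))
    = (\<Sum>t\<in>S. (of_bool (t \<in> {max x y..<min x y + int N}) :: real))"
    by (intro sum.cong refl) auto
  also have "\<dots> = real (card {t\<in>S. t \<in> {max x y..<min x y + int N}})"
    using assms(1) by (simp add: Int_def)
  also have "{t\<in>S. t \<in> {max x y..<min x y + int N}} = {max x y..<min x y + int N}"
  proof -
    have "{max x y..<min x y + int N} \<subseteq> {x..<x + int N}" by auto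
    with assms(2) show ?thesis by blast
  qed
  also have "real (card {max x y..<min x y + int N}) = overlap N (x - y)"
    by (auto simp: overlap_def max_def min_def)
  finally show ?thesis by simp
qed

lemma sum_overlap:
  assumes "finite S" and "\<And>i. i \<in> I \<Longrightarrow> {p i..<p i + int N} \<subseteq> S"
  shows "(\<Sum>i\<in>I. \<Sum>j\<in>J. overlap N (p i - q j)) = (\<Sum>t\<in>S. window N I p t * window N J q t)"
proof -
  have "(\<Sum>i\<in>I. \<Sum>j\<in>J. overlap N (p i - q j)) =
     (\<Sum>i\<in>I. \<Sum>j\<in>J. \<Sum>t\<in>S. of_bool (t \<in> {p i..<p i + int N}) * of_bool (t \<in> {q j..<q j + int N}))"
    by (intro sum.cong refl overlap_eq_sum assms)
  also have "\<dots> = (\<Sum>i\<in>I. \<Sum>t\<in>S. \<Sum>j\<in>J. of_bool (t \<in> {p i..<p i + int N}) * of_bool (t \<in> {q j..<q j + int N}))"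
    by (intro sum.cong refl sum.swap)
  also have "\<dots> = (\<Sum>t\<in>S. \<Sum>i\<in>I. \<Sum>j\<in>J. of_bool (t \<in> {p i..<p i + int N}) * of_bool (t \<in> {q j..<q j + int N}))"
    by (rule sum.swap)
  also have "\<dots> = (\<Sum>t\<in>S. window N I p t * window N J q t)"
    unfolding window_def sum_product by simp
  finally show ?thesis .
qed

text \<open>The overlap is a positive semidefinite kernel, being a sum of products of window indicators.\<close>
lemma sum_overlap_Cauchy_Schwarz:
  assumes "finite I" and "finite J"
  shows "(\<Sum>i\<in>I. \<Sum>j\<in>J. overlap N (p i - q j))\<^sup>2
    \<le> (\<Sum>i\<in>I. \<Sum>j\<in>I. overlap N (p i - p j)) * (\<Sum>i\<in>J. \<Sum>j\<in>J. overlap N (q i - q j))"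
proof -
  define S where "S = (\<Union>i\<in>I. {p i..<p i + int N}) \<union> (\<Union>j\<in>J. {q j..<q j + int N})"
  have S: "finite S" "\<And>i. i \<in> I \<Longrightarrow> {p i..<p i + int N} \<subseteq> S"
    "\<And>j. j \<in> J \<Longrightarrow> {q j..<q j + int N} \<subseteq> S"
    unfolding S_def using assms by auto
  have "(\<Sum>t\<in>S. window N I p t * window N J q t)\<^sup>2
      \<le> (\<Sum>t\<in>S. (window N I p t)\<^sup>2) * (\<Sum>t\<in>S. (window N J q t)\<^sup>2)"
    by (rule Cauchy_Schwarz_ineq_sum)
  then show ?thesis
    using S by (simp add: sum_overlap[where S = S] power2_eq_square)
qed

lemma sum_overlap_le:
  assumes "finite D"
  shows "(\<Sum>d\<in>D. overlap N d) \<le> (real N)\<^sup>2"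
proof -
  have "(\<Sum>d\<in>{- int N<..<int N}. overlap N d) = (real N)\<^sup>2"
  proof (induction N)
    case (Suc N)
    have "(\<Sum>d\<in>{- int (Suc N)<..<int (Suc N)}. overlap (Suc N) d)
      = (\<Sum>d\<in>{- int (Suc N)<..<int (Suc N)}. overlap N d + 1)"
      by (intro sum.cong refl) (auto simp: overlap_def max_def)
    also have "\<dots> = (\<Sum>d\<in>{- int (Suc N)<..<int (Suc N)}. overlap N d) + (2 * real N + 1)"
      by (simp add: sum.distrib)
    also have "(\<Sum>d\<in>{- int (Suc N)<..<int (Suc N)}. overlap N d)
      = (\<Sum>d\<in>{- int N<..<int N}. overlap N d)"
      by (intro sum.mono_neutral_right) (auto simp: overlap_def max_def)
    finally show ?case using Suc by (simp add: power2_eq_square algebra_simps)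
  qed simp
  moreover have "(\<Sum>d\<in>D. overlap N d) = (\<Sum>d\<in>D \<inter> {- int N<..<int N}. overlap N d)"
    using assms by (intro sum.mono_neutral_right) (auto simp: overlap_def max_def)
  moreover have "\<dots> \<le> (\<Sum>d\<in>{- int N<..<int N}. overlap N d)"
    by (intro sum_mono2) (auto simp: overlap_nonneg)
  ultimately show ?thesis by simp
qed

section \<open>The energy of a finite set\<close>

text \<open>The lists of length \<open>k\<close> with entries in \<open>F\<close>.\<close>
definition tuples :: "nat \<Rightarrow> 'a set \<Rightarrow> 'a list set" where
  "tuples k F = {xs. set xs \<subseteq> F \<and> length xs = k}"

text \<open>The weighted number of pairs of \<open>k\<close>-tuples over \<open>F\<close> whose sums differ by less than \<open>N\<close>.
  Tuples are ordered, so that sums over them factor.\<close>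
definition energy :: "nat \<Rightarrow> nat set \<Rightarrow> nat \<Rightarrow> real" where
  "energy N F k = (\<Sum>xs\<in>tuples k F. \<Sum>ys\<in>tuples k F.
     overlap N (int (sum_list xs) - int (sum_list ys)))"

lemma finite_tuples: "finite F \<Longrightarrow> finite (tuples k F)"
  unfolding tuples_def by (rule finite_lists_length_eq)

lemma tuples_0: "tuples 0 F = {[]}"
  by (auto simp: tuples_def)

lemma sum_tuples_Suc:
  "(\<Sum>zs\<in>tuples (Suc k) F. g zs) = (\<Sum>x\<in>F. \<Sum>xs\<in>tuples k F. g (x # xs))"
proof -
  have "tuples (Suc k) F = (\<lambda>(x, xs). x # xs) ` (F \<times> tuples k F)"
    by (auto simp: tuples_def length_Suc_conv image_iff)
  moreover have "inj_on (\<lambda>(x, xs). x # xs) (F \<times> tuples k F)"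
    by (auto simp: inj_on_def)
  ultimately show ?thesis
    by (simp add: sum.reindex sum.cartesian_product case_prod_unfold)
qed

lemma sum_tuples_exp:
  fixes s :: real
  shows "(\<Sum>xs\<in>tuples k F. exp (- s * real (sum_list xs))) = (\<Sum>a\<in>F. exp (- s * real a)) ^ k"
proof (induction k)
  case (Suc k)
  have "(\<Sum>x\<in>F. \<Sum>xs\<in>tuples k F. exp (- s * real (sum_list (x # xs))))
    = (\<Sum>x\<in>F. \<Sum>xs\<in>tuples k F. exp (- s * real x) * exp (- s * real (sum_list xs)))"
    by (simp add: exp_add[symmetric] algebra_simps)
  also have "\<dots> = (\<Sum>a\<in>F. exp (- s * real a)) ^ Suc k"
    using Suc by (simp add: sum_product[symmetric])
  finally show ?case by (simp only: sum_tuples_Suc)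
qed (simp add: tuples_0)

lemma energy_nonneg: "energy N F k \<ge> 0"
  unfolding energy_def by (intro sum_nonneg overlap_nonneg)

lemma energy_0: "energy N F 0 = real N"
  by (simp add: energy_def tuples_0 overlap_def)

text \<open>The left-hand side is rewritten by moving one entry of the second tuple to the other side:
  it becomes a sum over pairs of a point \<open>x\<^sub>1 + \<dots> + x\<^bsub>j+1\<^esub> - y\<close> and a point \<open>y\<^sub>1 + \<dots> + y\<^sub>j\<close>.
  The Cauchy-Schwarz inequality separates the two families, and the first of them has the
  energy of the \<open>(j+2)\<close>-fold sums.\<close>
lemma energy_log_convex:
  assumes "finite F"
  shows "(energy N F (Suc j))\<^sup>2 \<le> energy N F j * energy N F (Suc (Suc j))"
proof -
  let ?T = "\<lambda>j. tuples j F"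
  define p where "p = (\<lambda>(xs, y). int (sum_list xs) - int y)"
  define q where "q = (\<lambda>ys. int (sum_list ys))"
  have fin: "finite (?T (Suc j) \<times> F)" "finite (?T j)"
    using assms by (auto intro: finite_tuples)
  have "energy N F (Suc j) = (\<Sum>xs\<in>?T (Suc j). \<Sum>y\<in>F. \<Sum>ys\<in>?T j. overlap N (p (xs, y) - q ys))"
    unfolding energy_def p_def q_def
    by (simp add: sum_tuples_Suc[where g = "\<lambda>ys. overlap N (int (sum_list xs) - int (sum_list ys))" for xs]
        algebra_simps)
  then have 1: "energy N F (Suc j) = (\<Sum>z\<in>?T (Suc j) \<times> F. \<Sum>ys\<in>?T j. overlap N (p z - q ys))"
    by (simp only: sum.cartesian_product')
  have "(\<Sum>z\<in>?T (Suc j) \<times> F. \<Sum>z'\<in>?T (Suc j) \<times> F. overlap N (p z - p z'))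
    = (\<Sum>xs\<in>?T (Suc j). \<Sum>y\<in>F. \<Sum>xs'\<in>?T (Suc j). \<Sum>y'\<in>F. overlap N (p (xs, y) - p (xs', y')))"
    by (simp only: sum.cartesian_product')
  also have "\<dots> = (\<Sum>xs\<in>?T (Suc j). \<Sum>y\<in>F. \<Sum>y'\<in>F. \<Sum>xs'\<in>?T (Suc j). overlap N (p (xs, y) - p (xs', y')))"
    by (intro sum.cong refl sum.swap)
  also have "\<dots> = (\<Sum>xs\<in>?T (Suc j). \<Sum>y'\<in>F. \<Sum>y\<in>F. \<Sum>xs'\<in>?T (Suc j). overlap N (p (xs, y) - p (xs', y')))"
    by (intro sum.cong refl sum.swap)
  also have "\<dots> = (\<Sum>y'\<in>F. \<Sum>xs\<in>?T (Suc j). \<Sum>y\<in>F. \<Sum>xs'\<in>?T (Suc j). overlap N (p (xs, y) - p (xs', y')))"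
    by (rule sum.swap)
  also have "\<dots> = energy N F (Suc (Suc j))"
    unfolding energy_def p_def
    by (simp add: sum_tuples_Suc[of _ "Suc j"] algebra_simps)
  finally have 2: "(\<Sum>z\<in>?T (Suc j) \<times> F. \<Sum>z'\<in>?T (Suc j) \<times> F. overlap N (p z - p z'))
    = energy N F (Suc (Suc j))" .
  have 3: "(\<Sum>ys\<in>?T j. \<Sum>ys'\<in>?T j. overlap N (q ys - q ys')) = energy N F j"
    by (simp add: energy_def q_def)
  from sum_overlap_Cauchy_Schwarz[OF fin, of N p q] show ?thesis
    by (simp add: 1 2 3 mult.commute)
qed

text \<open>Log-convexity iterated down to the energy \<open>N\<close> of the empty sum.\<close>
lemma energy_power_le:
  assumes "finite F"
  shows "energy N F j ^ Suc j \<le> real N * energy N F (Suc j) ^ j"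
proof (induction j)
  case (Suc j)
  let ?a = "energy N F j" and ?b = "energy N F (Suc j)" and ?c = "energy N F (Suc (Suc j))"
  have nonneg: "?a \<ge> 0" "?b \<ge> 0" "?c \<ge> 0"
    by (rule energy_nonneg)+
  show ?case
  proof (cases "?b = 0")
    case False
    with nonneg have b: "?b > 0" by simp
    have "?b ^ j * ?b ^ Suc (Suc j) = (?b\<^sup>2) ^ Suc j"
      by (simp add: power2_eq_square power_mult_distrib mult_ac)
    also have "\<dots> \<le> (?a * ?c) ^ Suc j"
      by (intro power_mono energy_log_convex assms) simp
    also have "\<dots> = ?a ^ Suc j * ?c ^ Suc j"
      by (rule power_mult_distrib)
    also have "\<dots> \<le> (real N * ?b ^ j) * ?c ^ Suc j"
      by (intro mult_right_mono Suc zero_le_power nonneg)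
    finally have "?b ^ j * ?b ^ Suc (Suc j) \<le> ?b ^ j * (real N * ?c ^ Suc j)"
      by (simp add: mult_ac)
    then show ?thesis using b by simp
  qed (use nonneg in simp)
qed (simp add: energy_0)

section \<open>The energy of sets with distinct sums\<close>

lemma Bh_set_mset_eq:
  assumes "Bh_set h A" and "length xs = h" "length ys = h" "set xs \<subseteq> A" "set ys \<subseteq> A"
    and "sum_list xs = sum_list ys"
  shows "mset xs = mset ys"
proof -
  have "sum_list (sort zs) = sum_list zs" for zs :: "nat list"
  proof -
    have "sum_mset (mset (sort zs)) = sum_mset (mset zs)" by simp
    then show ?thesis by (simp only: sum_mset_sum_list)
  qed
  with assms have "sort xs = sort ys"
    unfolding Bh_set_def by (intro inj_onD[where f = sum_list]) auto
  then show ?thesis by (metis mset_sort)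
qed

lemma card_lists_same_mset_le: "card {ys. mset ys = mset xs} \<le> fact (length xs)"
proof -
  have "{ys. mset ys = mset xs} = permutations_of_multiset (mset xs)"
    by (simp add: permutations_of_multiset_def)
  then show ?thesis
    by (simp add: card_permutations_of_multiset)
qed

text \<open>If \<open>\<Sum>xs - \<Sum>ys = \<Sum>us - \<Sum>vs\<close>, then \<open>xs @ vs\<close> and \<open>us @ ys\<close> are \<open>2k\<close>-tuples with equal sums, hence
  equal as multisets. When \<open>xs\<close>, \<open>ys\<close> have no common entry and neither have \<open>us\<close>, \<open>vs\<close>, this forces
  \<open>us\<close> and \<open>vs\<close> to be permutations of \<open>xs\<close> and \<open>ys\<close>.\<close>
lemma card_disjoint_pairs_le:
  assumes "Bh_set (2 * k) A" and "F \<subseteq> A"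
  shows "card {(xs, ys). xs \<in> tuples k F \<and> ys \<in> tuples k F \<and> set xs \<inter> set ys = {} \<and>
     int (sum_list xs) - int (sum_list ys) = d} \<le> (fact k)\<^sup>2"
    (is "card ?D \<le> _")
proof (cases "?D = {}")
  case False
  then obtain xs ys where xy: "(xs, ys) \<in> ?D" by auto
  have "?D \<subseteq> {us. mset us = mset xs} \<times> {vs. mset vs = mset ys}"
  proof (clarsimp, rename_tac us vs)
    fix us vs
    assume uv: "us \<in> tuples k F" "vs \<in> tuples k F" "set us \<inter> set vs = {}"
      "d = int (sum_list us) - int (sum_list vs)"
    have "mset (xs @ vs) = mset (us @ ys)"
      using xy uv assms(2) by (intro Bh_set_mset_eq[OF assms(1)]) (auto simp: tuples_def)
    then have eq: "mset xs + mset vs = mset us + mset ys" by simp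
    have "set_mset (mset xs) \<inter> set_mset (mset ys) = {}" "set_mset (mset us) \<inter> set_mset (mset vs) = {}"
      using xy uv by auto
    then have disj: "count (mset xs) z = 0 \<or> count (mset ys) z = 0"
       "count (mset us) z = 0 \<or> count (mset vs) z = 0" for z
      by (auto simp: count_eq_zero_iff)
    have cnt: "count (mset xs) z + count (mset vs) z = count (mset us) z + count (mset ys) z" for z
      using arg_cong[OF eq, of "\<lambda>M. count M z"] by simp
    have "count (mset us) z = count (mset xs) z \<and> count (mset vs) z = count (mset ys) z" for z
      using disj[of z] cnt[of z] by arith
    then show "mset us = mset xs \<and> mset vs = mset ys"
      by (auto intro: multiset_eqI)
  qed
  moreover have "finite ({us. mset us = mset xs} \<times> {vs. mset vs = mset ys})"
    by (simp add: mset_eq_finite)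
  ultimately have "card ?D \<le> card ({us. mset us = mset xs} \<times> {vs. mset vs = mset ys})"
    by (intro card_mono)
  also have "\<dots> = card {us. mset us = mset xs} * card {vs. mset vs = mset ys}"
    by (rule card_cartesian_product)
  also have "\<dots> \<le> fact k * fact k"
    using xy card_lists_same_mset_le[of xs] card_lists_same_mset_le[of ys]
    by (intro mult_mono) (auto simp: tuples_def)
  finally show ?thesis by (simp add: power2_eq_square)
next
  case True
  show ?thesis unfolding True by simp
qed

lemma sum_disjoint_pairs_le:
  assumes "Bh_set (2 * k) A" and "F \<subseteq> A" and "finite F"
  shows "(\<Sum>(xs, ys) | xs \<in> tuples k F \<and> ys \<in> tuples k F \<and> set xs \<inter> set ys = {}.
    overlap N (int (sum_list xs) - int (sum_list ys))) \<le> (fact k)\<^sup>2 * (real N)\<^sup>2"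
proof -
  let ?D = "{(xs, ys). xs \<in> tuples k F \<and> ys \<in> tuples k F \<and> set xs \<inter> set ys = {}}"
  let ?g = "\<lambda>(xs, ys). int (sum_list xs) - int (sum_list ys)"
  have fin: "finite ?D"
    by (rule finite_subset[of _ "tuples k F \<times> tuples k F"]) (auto intro: finite_tuples assms)
  have "(\<Sum>(xs, ys)\<in>?D. overlap N (int (sum_list xs) - int (sum_list ys)))
    = (\<Sum>z\<in>?D. overlap N (?g z))" by (simp add: case_prod_unfold)
  also have "\<dots> = (\<Sum>d\<in>?g ` ?D. \<Sum>z\<in>{z\<in>?D. ?g z = d}. overlap N (?g z))"
    using fin by (intro sum.group[symmetric]) auto
  also have "\<dots> = (\<Sum>d\<in>?g ` ?D. real (card {z\<in>?D. ?g z = d}) * overlap N d)"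
    by (intro sum.cong refl) simp
  also have "\<dots> \<le> (\<Sum>d\<in>?g ` ?D. (fact k)\<^sup>2 * overlap N d)"
  proof (intro sum_mono mult_right_mono overlap_nonneg)
    fix d
    have "{z\<in>?D. ?g z = d} = {(xs, ys). xs \<in> tuples k F \<and> ys \<in> tuples k F \<and> set xs \<inter> set ys = {} \<and>
     int (sum_list xs) - int (sum_list ys) = d}" by auto
    then have "card {z\<in>?D. ?g z = d} \<le> (fact k)\<^sup>2"
      using card_disjoint_pairs_le[OF assms(1,2), of d] by simp
    then show "real (card {z\<in>?D. ?g z = d}) \<le> (fact k)\<^sup>2"
      using of_nat_mono[where 'a = real] by fastforce
  qed
  also have "\<dots> \<le> (fact k)\<^sup>2 * (real N)\<^sup>2"
    unfolding sum_distrib_left[symmetric]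
    using fin by (intro mult_left_mono sum_overlap_le) auto
  finally show ?thesis .
qed

text \<open>Deleting a common entry from both tuples does not change the difference of the sums; there are
  at most \<open>j + 1\<close> positions for it in each tuple and \<open>card F\<close> values.\<close>
lemma sum_nondisjoint_pairs_le:
  assumes "finite F"
  shows "(\<Sum>(xs, ys) | xs \<in> tuples (Suc j) F \<and> ys \<in> tuples (Suc j) F \<and> set xs \<inter> set ys \<noteq> {}.
    overlap N (int (sum_list xs) - int (sum_list ys))) \<le> (real (Suc j))\<^sup>2 * real (card F) * energy N F j"
proof -
  let ?E = "{(xs, ys). xs \<in> tuples (Suc j) F \<and> ys \<in> tuples (Suc j) F \<and> set xs \<inter> set ys \<noteq> {}}"
  let ?g = "\<lambda>(xs, ys). overlap N (int (sum_list xs) - int (sum_list ys))"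
  \<comment> \<open>\<open>ins i c xs\<close> inserts \<open>c\<close> into \<open>xs\<close> at position \<open>i\<close>.\<close>
  define ins where "ins = (\<lambda>i (c::nat) xs. take i xs @ c # drop i xs)"
  define \<phi> where "\<phi> = (\<lambda>((i, i'), c, xs, ys). (ins i c xs, ins i' c ys))"
  define X where "X = ({..j} \<times> {..j}) \<times> F \<times> tuples j F \<times> tuples j F"
  have sum_ins: "sum_list (ins i c xs) = c + sum_list xs" for i c xs
  proof -
    have "sum_list xs = sum_list (take i xs) + sum_list (drop i xs)"
      by (simp flip: sum_list_append)
    then show ?thesis by (simp add: ins_def)
  qed
  have split: "\<exists>i\<le>j. \<exists>us\<in>tuples j F. xs = ins i c us" if xs: "xs \<in> tuples (Suc j) F" and c: "c \<in> set xs" for xs c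
  proof -
    obtain us vs where "xs = us @ c # vs" using c by (meson split_list)
    with xs show ?thesis
      by (intro exI[of _ "length us"] conjI bexI[of _ "us @ vs"]) (auto simp: ins_def tuples_def)
  qed
  have fin: "finite X" unfolding X_def using assms by (auto intro: finite_tuples)
  have "?E \<subseteq> \<phi> ` X"
  proof clarify
    fix xs ys assume xy: "xs \<in> tuples (Suc j) F" "ys \<in> tuples (Suc j) F" "set xs \<inter> set ys \<noteq> {}"
    then obtain c where c: "c \<in> set xs" "c \<in> set ys" by auto
    from split[OF xy(1) c(1)] split[OF xy(2) c(2)] obtain i i' us vs
      where *: "i \<le> j" "i' \<le> j" "us \<in> tuples j F" "vs \<in> tuples j F" "xs = ins i c us" "ys = ins i' c vs"
      by blast
    moreover have "c \<in> F" using xy c by (auto simp: tuples_def)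
    ultimately show "(xs, ys) \<in> \<phi> ` X"
      by (intro image_eqI[of _ _ "((i, i'), c, us, vs)"]) (auto simp: \<phi>_def X_def)
  qed
  then have "(\<Sum>z\<in>?E. ?g z) \<le> (\<Sum>z\<in>\<phi> ` X. ?g z)"
    using fin by (intro sum_mono2) (auto simp: overlap_nonneg)
  also have "\<dots> \<le> (\<Sum>w\<in>X. ?g (\<phi> w))"
    using sum_image_le[of X ?g \<phi>] fin by (auto simp: overlap_nonneg case_prod_unfold o_def)
  also have "\<dots> = (\<Sum>w\<in>({..j} \<times> {..j}). \<Sum>c\<in>F. energy N F j)"
    unfolding X_def energy_def sum.cartesian_product
    by (intro sum.cong refl) (simp add: \<phi>_def sum_ins case_prod_unfold)
  also have "\<dots> = (real (Suc j))\<^sup>2 * real (card F) * energy N F j"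
    by (simp add: power2_eq_square algebra_simps)
  finally show ?thesis by (simp add: case_prod_unfold)
qed

lemma energy_le_step:
  assumes "Bh_set (2 * Suc j) A" and "F \<subseteq> A" and "finite F"
  shows "energy N F (Suc j) \<le> (fact (Suc j))\<^sup>2 * (real N)\<^sup>2
    + (real (Suc j))\<^sup>2 * real (card F) * energy N F j"
proof -
  let ?T = "tuples (Suc j) F"
  let ?D = "{(xs, ys). xs \<in> ?T \<and> ys \<in> ?T \<and> set xs \<inter> set ys = {}}"
  let ?E = "{(xs, ys). xs \<in> ?T \<and> ys \<in> ?T \<and> set xs \<inter> set ys \<noteq> {}}"
  let ?g = "\<lambda>(xs, ys). overlap N (int (sum_list xs) - int (sum_list ys))"
  have fin: "finite (?T \<times> ?T)" by (auto intro: finite_tuples assms)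
  have "energy N F (Suc j) = (\<Sum>z\<in>?T \<times> ?T. ?g z)"
    by (simp add: energy_def sum.cartesian_product)
  also have "?T \<times> ?T = ?D \<union> ?E" by auto
  also have "(\<Sum>z\<in>?D \<union> ?E. ?g z) = (\<Sum>z\<in>?D. ?g z) + (\<Sum>z\<in>?E. ?g z)"
    by (intro sum.union_disjoint finite_subset[OF _ fin]) auto
  finally show ?thesis
    using sum_disjoint_pairs_le[OF assms, of N] sum_nondisjoint_pairs_le[OF assms(3), where j = j and N = N] by simp
qed

section \<open>Hilbert's inequality and the exponential test function\<close>

text \<open>The function \<open>2 arctan \<radical>(y/m) / \<radical>m\<close> is an antiderivative of \<open>1 / (\<radical>y (m + y))\<close> in \<open>y\<close>. The estimate
  below goes through \<open>\<radical>(y/m)\<close> as the variable, which avoids the singularity at \<open>y = 0\<close>.\<close>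

lemma arctan_increment:
  fixes m n :: nat
  assumes "m \<ge> 1" "n \<ge> 1"
  shows "1 / (sqrt n * (real m + real n))
    \<le> 2 / sqrt m * (arctan (sqrt (real n / m)) - arctan (sqrt (real (n - 1) / m)))"
proof -
  define a b where "a = sqrt (real (n - 1) / m)" and "b = sqrt (real n / m)"
  have ab: "0 \<le> a" "a < b" "b\<^sup>2 = real n / m" "b\<^sup>2 - a\<^sup>2 = 1 / m"
    using assms by (auto simp: a_def b_def field_simps of_nat_diff)
  obtain z where z: "a < z" "z < b" "arctan b - arctan a = (b - a) * inverse (1 + z\<^sup>2)"
    using MVT2[of a b arctan "\<lambda>z. inverse (1 + z\<^sup>2)"] ab DERIV_arctan by blast
  have "(1 / m) / (2 * b) = (b\<^sup>2 - a\<^sup>2) / (2 * b)" using ab by simp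
  also have "\<dots> = (b - a) * ((b + a) / (2 * b))" by (simp add: power2_eq_square algebra_simps)
  also have "\<dots> \<le> (b - a) * 1" using ab by (intro mult_left_mono) (auto simp: field_simps)
  finally have 1: "(1 / m) / (2 * b) \<le> b - a" by simp
  have 2: "inverse (1 + z\<^sup>2) \<ge> inverse (1 + b\<^sup>2)"
    using z ab by (intro le_imp_inverse_le add_left_mono power_mono) (auto intro: add_pos_nonneg)
  have "(1 / m) / (2 * b) * inverse (1 + b\<^sup>2) \<le> arctan b - arctan a"
    unfolding z(3) using ab assms 1 2 by (intro mult_mono) auto
  then have "2 / sqrt m * ((1 / m) / (2 * b) * inverse (1 + b\<^sup>2)) \<le> 2 / sqrt m * (arctan b - arctan a)"
    by (rule mult_left_mono) simp
  moreover have "2 / sqrt m * ((1 / m) / (2 * b) * inverse (1 + b\<^sup>2)) = 1 / (sqrt n * (real m + real n))"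
  proof -
    have "sqrt m * b = sqrt n"
      using assms by (simp add: b_def flip: real_sqrt_mult)
    moreover have "real m * (1 + b\<^sup>2) = real m + real n"
      using assms ab by (simp add: field_simps)
    ultimately have "1 / (sqrt n * (real m + real n)) = 1 / ((sqrt m * b) * (real m * (1 + b\<^sup>2)))" by simp
    moreover have "2 / x * ((1 / y) / (2 * b) * inverse w) = 1 / ((x * b) * (y * w))" for x y w :: real
      by (cases "x = 0"; cases "y = 0"; cases "w = 0"; cases "b = 0"; simp add: field_simps)
    ultimately show ?thesis by (simp only:)
  qed
  ultimately show ?thesis by (simp add: a_def b_def)
qed

lemma sum_sqrt_kernel_le:
  fixes m :: nat
  assumes "finite I" "0 \<notin> I" "m \<ge> 1"
  shows "(\<Sum>n\<in>I. 1 / (sqrt (real n) * (real m + real n))) \<le> pi / sqrt m"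
proof -
  obtain K where K: "\<forall>n\<in>I. n < K" using assms(1) finite_nat_set_iff_bounded by blast
  have "(\<Sum>n\<in>I. 1 / (sqrt (real n) * (real m + real n))) \<le> (\<Sum>n\<in>{1..K}. 1 / (sqrt (real n) * (real m + real n)))"
  proof (rule sum_mono2)
    show "I \<subseteq> {1..K}"
    proof
      fix n assume "n \<in> I"
      then show "n \<in> {1..K}" using K assms(2) by (cases "n = 0") auto
    qed
  qed auto
  also have "\<dots> \<le> 2 / sqrt m * arctan (sqrt (real K / m))"
  proof (induction K)
    case (Suc K)
    then show ?case using arctan_increment[OF assms(3), of "Suc K"] by (simp add: algebra_simps)
  qed simp
  also have "\<dots> \<le> 2 / sqrt m * (pi / 2)"
    using arctan_ubound[of "sqrt (real K / m)"] by (intro mult_left_mono) auto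
  finally show ?thesis by simp
qed

text \<open>The Schur test with test function \<open>1 / \<radical>m\<close>, using the preceding bound on the sums over rows.\<close>
lemma Hilbert_inequality:
  fixes v :: "nat \<Rightarrow> real"
  assumes "finite I" "0 \<notin> I"
  shows "(\<Sum>m\<in>I. \<Sum>n\<in>I. v m * v n / (real m + real n)) \<le> pi * (\<Sum>m\<in>I. (v m)\<^sup>2)"
proof -
  let ?g = "\<lambda>m n. (v m)\<^sup>2 * sqrt (real m) * (1 / (sqrt (real n) * (real m + real n)))"
  have pos: "real m > 0" if "m \<in> I" for m
    using that assms(2) by (cases m) auto
  have "(\<Sum>m\<in>I. \<Sum>n\<in>I. v m * v n / (real m + real n)) \<le> (\<Sum>m\<in>I. \<Sum>n\<in>I. (?g m n + ?g n m) / 2)"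
  proof (intro sum_mono)
    fix m n assume mn: "m \<in> I" "n \<in> I"
    define x y where "x = sqrt (real m)" and "y = sqrt (real n)"
    have xy: "x > 0" "y > 0" using pos mn by (auto simp: x_def y_def)
    have "0 \<le> (v m * x - v n * y)\<^sup>2 / (x * y)" using xy by simp
    also have "\<dots> = (v m)\<^sup>2 * x / y + (v n)\<^sup>2 * y / x - 2 * (v m * v n)"
      using xy by (simp add: field_simps power2_eq_square)
    finally have "v m * v n / (real m + real n) \<le> (((v m)\<^sup>2 * x / y + (v n)\<^sup>2 * y / x) / 2) / (real m + real n)"
      using pos mn by (intro divide_right_mono) auto
    also have "\<dots> = (?g m n + ?g n m) / 2"
      by (simp add: x_def[symmetric] y_def[symmetric] add_divide_distrib add.commute mult_ac)
    finally show "v m * v n / (real m + real n) \<le> (?g m n + ?g n m) / 2" .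
  qed
  also have "\<dots> = ((\<Sum>m\<in>I. \<Sum>n\<in>I. ?g m n) + (\<Sum>m\<in>I. \<Sum>n\<in>I. ?g n m)) / 2"
    by (simp add: sum.distrib flip: sum_divide_distrib)
  also have "(\<Sum>m\<in>I. \<Sum>n\<in>I. ?g n m) = (\<Sum>m\<in>I. \<Sum>n\<in>I. ?g m n)"
    by (rule sum.swap)
  also have "((\<Sum>m\<in>I. \<Sum>n\<in>I. ?g m n) + (\<Sum>m\<in>I. \<Sum>n\<in>I. ?g m n)) / 2 = (\<Sum>m\<in>I. \<Sum>n\<in>I. ?g m n)"
    by simp
  also have "\<dots> = (\<Sum>m\<in>I. (v m)\<^sup>2 * sqrt (real m) * (\<Sum>n\<in>I. 1 / (sqrt (real n) * (real m + real n))))"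
    by (simp only: sum_distrib_left)
  also have "\<dots> \<le> (\<Sum>m\<in>I. (v m)\<^sup>2 * sqrt (real m) * (pi / sqrt (real m)))"
  proof (intro sum_mono mult_left_mono sum_sqrt_kernel_le assms)
    fix m assume "m \<in> I"
    with pos[OF this] show "1 \<le> m" by simp
  qed simp
  also have "\<dots> = pi * (\<Sum>m\<in>I. (v m)\<^sup>2)"
    unfolding sum_distrib_left using pos by (intro sum.cong refl) auto
  finally show ?thesis .
qed

lemma sum_exp_le_inverse:
  fixes u :: real
  assumes "u > 0"
  shows "(\<Sum>t\<in>{1..int K}. exp (- u * real_of_int t)) \<le> 1 / u"
proof -
  have "(\<Sum>t\<in>{1..int K}. exp (- u * real_of_int t)) = (\<Sum>t\<in>{1..K}. exp (- u * real t))"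
    by (rule sum.reindex_bij_witness[of _ int nat]) auto
  also have "\<dots> \<le> (1 - exp (- u * real K)) / u"
  proof (induction K)
    case (Suc K)
    have "exp (- u * real (Suc K)) * (1 + u) \<le> exp (- u * real (Suc K)) * exp u"
      by (intro mult_left_mono exp_ge_add_one_self) simp
    also have "\<dots> = exp (- u * real K)"
      by (simp add: algebra_simps flip: exp_add)
    finally have "u * exp (- u * real (Suc K)) \<le> exp (- u * real K) - exp (- u * real (Suc K))"
      by (simp add: algebra_simps)
    then have "exp (- u * real (Suc K)) \<le> (exp (- u * real K) - exp (- u * real (Suc K))) / u"
      using assms by (simp add: field_simps)
    then show ?case using Suc by (simp add: diff_divide_distrib)
  qed simp
  also have "\<dots> \<le> 1 / u"
    using assms by (intro divide_right_mono) auto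
  finally show ?thesis .
qed

lemma sum_exp_weight_square_le:
  fixes v :: "nat \<Rightarrow> real"
  assumes "finite I" "0 \<notin> I" "\<And>m. m \<in> I \<Longrightarrow> v m \<ge> 0"
  shows "(\<Sum>t\<in>{1..int K}. (\<Sum>m\<in>I. v m / real m * exp (- real_of_int t / real m))\<^sup>2)
    \<le> pi * (\<Sum>m\<in>I. (v m)\<^sup>2)"
proof -
  let ?e = "\<lambda>m n. 1 / real m + 1 / real n"
  have pos: "real m > 0" if "m \<in> I" for m
    using that assms(2) by (cases m) auto
  have "(\<Sum>t\<in>{1..int K}. (\<Sum>m\<in>I. v m / real m * exp (- real_of_int t / real m))\<^sup>2)
    = (\<Sum>t\<in>{1..int K}. \<Sum>m\<in>I. \<Sum>n\<in>I. v m / real m * (v n / real n) * exp (- ?e m n * real_of_int t))"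
    by (simp add: power2_eq_square sum_product mult_exp_exp algebra_simps)
  also have "\<dots> = (\<Sum>m\<in>I. \<Sum>n\<in>I. \<Sum>t\<in>{1..int K}. v m / real m * (v n / real n) * exp (- ?e m n * real_of_int t))"
    by (subst sum.swap, intro sum.cong refl sum.swap)
  also have "\<dots> = (\<Sum>m\<in>I. \<Sum>n\<in>I. v m / real m * (v n / real n) * (\<Sum>t\<in>{1..int K}. exp (- ?e m n * real_of_int t)))"
    by (simp only: sum_distrib_left)
  also have "\<dots> \<le> (\<Sum>m\<in>I. \<Sum>n\<in>I. v m / real m * (v n / real n) * (1 / ?e m n))"
    using pos assms(3) by (intro sum_mono mult_left_mono sum_exp_le_inverse) (auto intro: add_pos_pos)
  also have "\<dots> = (\<Sum>m\<in>I. \<Sum>n\<in>I. v m * v n / (real m + real n))"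
  proof (intro sum.cong refl)
    fix m n assume "m \<in> I" "n \<in> I"
    then have "real m > 0" "real n > 0" using pos by auto
    then show "v m / real m * (v n / real n) * (1 / ?e m n) = v m * v n / (real m + real n)"
      by (simp add: divide_simps)
  qed
  also have "\<dots> \<le> pi * (\<Sum>m\<in>I. (v m)\<^sup>2)"
    by (rule Hilbert_inequality[OF assms(1,2)])
  finally show ?thesis .
qed

text \<open>The Cauchy-Schwarz inequality for the number of sums in a window and the weight
  \<open>W(t) = \<Sum>\<^sub>m v\<^sub>m e\<^bsup>-t/m\<^esup> / m\<close>. The hypotheses on \<open>F\<close> and \<open>k\<close> make all sums of tuples positive, so that only
  \<open>t \<ge> 1\<close> matters. The factor \<open>e\<^bsup>-N/m\<^esup>\<close> accounts for the variation of \<open>e\<^bsup>-t/m\<^esup>\<close> inside a window.\<close>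
lemma exp_sums_le_energy:
  fixes v :: "nat \<Rightarrow> real"
  assumes "finite F" "0 \<notin> F" "k > 0"
    and "finite I" "0 \<notin> I" "\<And>m. m \<in> I \<Longrightarrow> v m \<ge> 0"
  shows "(real N * (\<Sum>m\<in>I. v m / real m * exp (- real N / real m) * (\<Sum>a\<in>F. exp (- real a / real m)) ^ k))\<^sup>2
    \<le> energy N F k * (pi * (\<Sum>m\<in>I. (v m)\<^sup>2))"
proof -
  define T where "T = tuples k F"
  define p where "p = (\<lambda>xs. int (sum_list xs))"
  define W where "W = (\<lambda>t. \<Sum>m\<in>I. v m / real m * exp (- real_of_int t / real m))"
  define K where "K = (\<Sum>xs\<in>T. sum_list xs) + N"
  define S where "S = {1..int K}"
  have finT: "finite T" unfolding T_def by (rule finite_tuples) fact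
  have sub: "{p xs..<p xs + int N} \<subseteq> S" if "xs \<in> T" for xs
  proof -
    have "int (sum_list xs) \<le> (\<Sum>xs\<in>T. int (sum_list xs))"
      using that finT by (intro member_le_sum) auto
    moreover have "sum_list xs > 0"
    proof -
      from that assms(3) obtain x zs where "xs = x # zs" "x \<in> F"
        by (cases xs) (auto simp: T_def tuples_def)
      moreover have "x \<noteq> 0" using \<open>x \<in> F\<close> assms(2) by metis
      ultimately show ?thesis by simp
    qed
    ultimately show ?thesis by (auto simp: S_def p_def K_def)
  qed
  have energy: "energy N F k = (\<Sum>t\<in>S. (window N T p t)\<^sup>2)"
    unfolding energy_def T_def[symmetric] power2_eq_square
    by (subst sum_overlap[symmetric]) (use sub in \<open>auto simp: S_def p_def\<close>)
  have "real N * (\<Sum>m\<in>I. v m / real m * exp (- real N / real m) * (\<Sum>a\<in>F. exp (- real a / real m)) ^ k)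
    = (\<Sum>xs\<in>T. real N * (\<Sum>m\<in>I. v m / real m * exp (- real_of_int (p xs + int N) / real m)))"
  proof -
    have "(\<Sum>a\<in>F. exp (- real a / real m)) ^ k = (\<Sum>xs\<in>T. exp (- real (sum_list xs) / real m))" for m
      using sum_tuples_exp[where k = k and F = F and s = "1 / real m"] by (simp add: T_def)
    moreover have "exp (- real_of_int (p xs + int N) / real m)
      = exp (- real N / real m) * exp (- real (sum_list xs) / real m)" for xs m
      by (simp add: p_def diff_divide_distrib flip: exp_add)
    ultimately have "real N * (\<Sum>m\<in>I. v m / real m * exp (- real N / real m) * (\<Sum>a\<in>F. exp (- real a / real m)) ^ k)
      = (\<Sum>m\<in>I. \<Sum>xs\<in>T. real N * (v m / real m * exp (- real_of_int (p xs + int N) / real m)))"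
      by (simp add: sum_distrib_left sum_divide_distrib mult_ac)
    also have "\<dots> = (\<Sum>xs\<in>T. \<Sum>m\<in>I. real N * (v m / real m * exp (- real_of_int (p xs + int N) / real m)))"
      by (rule sum.swap)
    finally show ?thesis by (simp add: sum_distrib_left)
  qed
  also have "\<dots> \<le> (\<Sum>xs\<in>T. \<Sum>t\<in>{p xs..<p xs + int N}. W t)"
  proof (intro sum_mono)
    fix xs
    have "real N * (\<Sum>m\<in>I. v m / real m * exp (- real_of_int (p xs + int N) / real m))
      = (\<Sum>t\<in>{p xs..<p xs + int N}. (\<Sum>m\<in>I. v m / real m * exp (- real_of_int (p xs + int N) / real m)))"
      by simp
    also have "\<dots> \<le> (\<Sum>t\<in>{p xs..<p xs + int N}. W t)"
      unfolding W_def
    proof (intro sum_mono mult_left_mono)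
      fix t m assume "t \<in> {p xs..<p xs + int N}" "m \<in> I"
      then have "- real_of_int (p xs + int N) \<le> - real_of_int t"
        by (subst neg_le_iff_le, subst of_int_le_iff) simp
      then show "exp (- real_of_int (p xs + int N) / real m) \<le> exp (- real_of_int t / real m)"
        by (simp only: exp_le_cancel_iff) (rule divide_right_mono, auto)
    qed (use assms(6) in auto)
    finally show "real N * (\<Sum>m\<in>I. v m / real m * exp (- real_of_int (p xs + int N) / real m))
      \<le> (\<Sum>t\<in>{p xs..<p xs + int N}. W t)" .
  qed
  also have "\<dots> = (\<Sum>xs\<in>T. \<Sum>t\<in>S. of_bool (t \<in> {p xs..<p xs + int N}) * W t)"
    using sub by (intro sum.cong refl sum.mono_neutral_cong_left) (auto simp: S_def)
  also have "\<dots> = (\<Sum>t\<in>S. window N T p t * W t)"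
    unfolding window_def sum_distrib_right by (rule sum.swap)
  finally have le: "real N * (\<Sum>m\<in>I. v m / real m * exp (- real N / real m) * (\<Sum>a\<in>F. exp (- real a / real m)) ^ k)
    \<le> (\<Sum>t\<in>S. window N T p t * W t)" .
  have "0 \<le> real N * (\<Sum>m\<in>I. v m / real m * exp (- real N / real m) * (\<Sum>a\<in>F. exp (- real a / real m)) ^ k)"
    using assms(6) by (intro mult_nonneg_nonneg sum_nonneg zero_le_power) auto
  with le have "(real N * (\<Sum>m\<in>I. v m / real m * exp (- real N / real m) * (\<Sum>a\<in>F. exp (- real a / real m)) ^ k))\<^sup>2
    \<le> (\<Sum>t\<in>S. window N T p t * W t)\<^sup>2"
    by (intro power_mono) auto
  also have "\<dots> \<le> (\<Sum>t\<in>S. (window N T p t)\<^sup>2) * (\<Sum>t\<in>S. (W t)\<^sup>2)"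
    by (rule Cauchy_Schwarz_ineq_sum)
  also have "\<dots> \<le> energy N F k * (pi * (\<Sum>m\<in>I. (v m)\<^sup>2))"
    unfolding energy W_def S_def
    by (intro mult_left_mono sum_exp_weight_square_le assms sum_nonneg) auto
  finally show ?thesis .
qed

section \<open>The exponential sum over a sequence of bounded growth\<close>

text \<open>This is \<open>\<integral>\<^sub>0\<^sup>u exp (- x\<^sup>h) dx\<close> for \<open>u \<ge> 0\<close>, written after the substitution \<open>t = x\<^sup>h\<close> and an integration by
  parts. In this form the integrand is continuous at \<open>0\<close>, and the limit at infinity is Euler's
  integral for \<open>\<Gamma>(1 + 1/h)\<close>.\<close>

definition gamma_aux :: "nat \<Rightarrow> real \<Rightarrow> real" where
  "gamma_aux h u = integral {0..u ^ h} (\<lambda>t. t powr (1 / real h) / exp t) + u * exp (- (u ^ h))"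

lemma continuous_Gamma_integrand:
  "h > 0 \<Longrightarrow> continuous_on {0..y} (\<lambda>t::real. t powr (1 / real h) / exp t)"
  by (intro continuous_intros continuous_on_powr') auto

lemma gamma_aux_deriv:
  assumes "h > 0" "u > 0"
  shows "(gamma_aux h has_real_derivative exp (- (u ^ h))) (at u)"
proof -
  let ?f = "\<lambda>t::real. t powr (1 / real h) / exp t"
  have "((\<lambda>y. integral {0..y} ?f) has_real_derivative ?f (u ^ h)) (at (u ^ h) within {0..u ^ h + 1})"
    using assms by (intro integral_has_real_derivative continuous_Gamma_integrand) auto
  then have "((\<lambda>y. integral {0..y} ?f) has_real_derivative ?f (u ^ h)) (at (u ^ h))"
    using assms by (subst (asm) at_within_Icc_at) auto
  moreover have "?f (u ^ h) = u * exp (- (u ^ h))"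
    using assms by (simp add: exp_minus powr_realpow[symmetric] powr_powr field_simps)
  ultimately have D: "((\<lambda>y. integral {0..y} ?f) has_real_derivative u * exp (- (u ^ h))) (at (u ^ h))"
    by simp
  have "((\<lambda>u. u ^ h) has_real_derivative real h * u ^ (h - 1)) (at u)"
    by (auto intro!: derivative_eq_intros)
  from DERIV_chain2[OF D this]
  have "((\<lambda>u. integral {0..u ^ h} ?f) has_real_derivative u * exp (- (u ^ h)) * (real h * u ^ (h - 1))) (at u)" .
  then show ?thesis
    unfolding gamma_aux_def by (auto intro!: derivative_eq_intros)
qed

lemma gamma_aux_mono:
  assumes "h > 0" "0 < u" "u \<le> w"
  shows "gamma_aux h u \<le> gamma_aux h w"
proof (rule DERIV_nonneg_imp_nondecreasing[OF assms(3)])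
  fix x assume "u \<le> x" "x \<le> w"
  then have "(gamma_aux h has_real_derivative exp (- (x ^ h))) (at x)"
    using assms by (intro gamma_aux_deriv) auto
  then show "\<exists>y. (gamma_aux h has_real_derivative y) (at x) \<and> 0 \<le> y"
    by (intro exI[of _ "exp (- (x ^ h))"]) simp
qed

lemma gamma_aux_increment:
  assumes "h > 0" "0 < u" "u < w"
  shows "gamma_aux h w - gamma_aux h u \<le> (w - u) * exp (- (u ^ h))"
proof -
  obtain z where z: "u < z" "z < w" "gamma_aux h w - gamma_aux h u = (w - u) * exp (- (z ^ h))"
    using MVT2[OF assms(3), of "gamma_aux h" "\<lambda>u. exp (- (u ^ h))"] gamma_aux_deriv[OF assms(1)] assms(2)
    by auto
  then show ?thesis
    using assms by (auto intro!: mult_left_mono power_mono)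
qed

lemma gamma_aux_le:
  assumes "h > 0" "0 < u"
  shows "gamma_aux h u \<le> u ^ h * u + u"
proof -
  let ?f = "\<lambda>t::real. t powr (1 / real h) / exp t"
  have "integral {0..u ^ h} ?f \<le> integral {0..u ^ h} (\<lambda>t. u)"
  proof (intro integral_le integrable_continuous_real continuous_Gamma_integrand assms continuous_intros)
    fix t assume t: "t \<in> {0..u ^ h}"
    then have "t powr (1 / real h) \<le> (u ^ h) powr (1 / real h)"
      by (intro powr_mono2) auto
    also have "\<dots> = u"
      using assms by (simp add: powr_realpow[symmetric] powr_powr)
    finally have "t powr (1 / real h) \<le> u" .
    moreover have "?f t \<le> t powr (1 / real h) / 1"
      using t by (intro divide_left_mono) auto
    ultimately show "?f t \<le> u" by simp
  qed
  also have "\<dots> = u ^ h * u" using assms by simp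
  finally have "integral {0..u ^ h} ?f \<le> u ^ h * u" .
  moreover have "u * exp (- (u ^ h)) \<le> u * 1"
    using assms by (intro mult_left_mono) auto
  ultimately show ?thesis unfolding gamma_aux_def by linarith
qed

lemma integral_Gamma_tendsto:
  assumes "h > 0"
  shows "((\<lambda>y. integral {0..y} (\<lambda>t. t powr (1 / real h) / exp t)) \<longlongrightarrow> Gamma (1 + 1 / real h)) at_top"
proof (rule tendstoI)
  let ?f = "\<lambda>t::real. t powr (1 / real h) / exp t"
  fix e :: real assume "e > 0"
  have "(?f has_integral Gamma (1 + 1 / real h)) {0..}"
    using Gamma_integral_real[of "1 + 1 / real h"] by (simp add: add_pos_nonneg)
  then have "\<forall>e>0. \<exists>B>0. \<forall>a b. ball 0 B \<subseteq> cbox a b \<longrightarrow>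
     norm (integral (cbox a b) (\<lambda>x. if x \<in> {0..} then ?f x else 0) - Gamma (1 + 1 / real h)) < e"
    unfolding has_integral_alt'[of ?f] by (rule conjunct2)
  with \<open>e > 0\<close> obtain B where B: "B > 0" "\<And>a b. ball 0 B \<subseteq> cbox a b \<Longrightarrow>
     norm (integral (cbox a b) (\<lambda>x. if x \<in> {0..} then ?f x else 0) - Gamma (1 + 1 / real h)) < e"
    by meson
  have "dist (integral {0..y} ?f) (Gamma (1 + 1 / real h)) < e" if "y \<ge> B" for y
  proof -
    have "ball 0 B \<subseteq> cbox (- y) y" using that by (auto simp: dist_real_def)
    note B(2)[OF this]
    also have "integral (cbox (- y) y) (\<lambda>x. if x \<in> {0..} then ?f x else 0) = integral ({0..} \<inter> {- y..y}) ?f"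
      by (subst integral_restrict_Int) (simp add: Int_commute)
    also have "{0..} \<inter> {- y..y} = {0..y}" using that B(1) by auto
    finally show ?thesis by (simp add: dist_norm)
  qed
  then show "\<forall>\<^sub>F y in at_top. dist (integral {0..y} ?f) (Gamma (1 + 1 / real h)) < e"
    by (auto simp: eventually_at_top_linorder)
qed

lemma gamma_aux_at_top:
  assumes "h > 0"
  shows "(gamma_aux h \<longlongrightarrow> Gamma (1 + 1 / real h)) at_top"
proof -
  have "filterlim (\<lambda>u::real. u ^ h) at_top at_top"
    using assms by (intro filterlim_pow_at_top filterlim_ident)
  from filterlim_compose[OF integral_Gamma_tendsto[OF assms] this]
  have "((\<lambda>u. integral {0..u ^ h} (\<lambda>t. t powr (1 / real h) / exp t)) \<longlongrightarrow> Gamma (1 + 1 / real h)) at_top" .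
  moreover have "((\<lambda>u::real. u * exp (- (u ^ h))) \<longlongrightarrow> 0) at_top"
  proof (rule tendsto_sandwich[of "\<lambda>_. 0" _ _ "\<lambda>u. u * exp (- u)"])
    show "\<forall>\<^sub>F u::real in at_top. u * exp (- (u ^ h)) \<le> u * exp (- u)"
      using eventually_ge_at_top[of 1] by eventually_elim (use assms in \<open>auto intro!: self_le_power\<close>)
    show "\<forall>\<^sub>F u::real in at_top. 0 \<le> u * exp (- (u ^ h))"
      using eventually_ge_at_top[of 0] by eventually_elim simp
    show "((\<lambda>u::real. u * exp (- u)) \<longlongrightarrow> 0) at_top" by real_asymp
  qed simp
  ultimately show ?thesis
    unfolding gamma_aux_def[abs_def] using tendsto_add by fastforce
qed

lemma gamma_aux_at_0:
  assumes "h > 0" "e > 0"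
  shows "eventually (\<lambda>u. gamma_aux h u < e) (at_right 0)"
proof -
  have "((\<lambda>u::real. u ^ h * u + u) \<longlongrightarrow> 0 ^ h * 0 + 0) (at_right 0)"
    by (intro tendsto_intros)
  then have "eventually (\<lambda>u::real. u ^ h * u + u < e) (at_right 0)"
    using assms by (intro order_tendstoD) auto
  with eventually_at_right_less[of "0::real"] show ?thesis
    by eventually_elim (use gamma_aux_le[OF assms(1)] in fastforce)
qed

lemma sum_exp_power_ge:
  assumes "h > 0" "Y > 0" "n0 \<ge> 1" "n0 \<le> Suc K"
  shows "(\<Sum>n = n0..K. exp (- ((real n / Y) ^ h)))
    \<ge> Y * (gamma_aux h (real (Suc K) / Y) - gamma_aux h (real n0 / Y))"
  using assms(4)
proof (induction K)
  case 0
  then have "n0 = Suc 0" using assms(3) by simp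
  then show ?case by simp
next
  case (Suc K)
  show ?case
  proof (cases "n0 = Suc (Suc K)")
    case False
    with Suc.prems have le: "n0 \<le> Suc K" by simp
    have "gamma_aux h (real (Suc (Suc K)) / Y) - gamma_aux h (real (Suc K) / Y)
      \<le> (real (Suc (Suc K)) / Y - real (Suc K) / Y) * exp (- ((real (Suc K) / Y) ^ h))"
      using assms by (intro gamma_aux_increment) (auto simp: divide_strict_right_mono)
    also have "real (Suc (Suc K)) / Y - real (Suc K) / Y = 1 / Y"
      by (simp add: diff_divide_distrib[symmetric])
    finally have "Y * (gamma_aux h (real (Suc (Suc K)) / Y) - gamma_aux h (real (Suc K) / Y))
      \<le> exp (- ((real (Suc K) / Y) ^ h))"
      using assms(2) by (simp add: field_simps)
    with Suc.IH[OF le] le show ?thesis by (simp add: algebra_simps)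
  qed simp
qed

text \<open>With \<open>z = m\<^bsup>1/h\<^esup>\<close>, all \<open>n \<le> z\<close> satisfy \<open>ln n \<le> (ln m) / h\<close>, hence \<open>a\<^sub>n / m \<le> (n / Y)\<^sup>h\<close>. The terms with
  \<open>n > z\<close> are dropped; the cut-off \<open>z / Y\<close> is a power of \<open>c (ln m) / h\<close>, which still tends to infinity.\<close>
lemma sum_exp_sequence_ge:
  fixes a :: "nat \<Rightarrow> real"
  assumes "h > 0" "c > 0" "n0 \<ge> 1"
    and a: "\<And>n. n \<ge> n0 \<Longrightarrow> a n \<le> c * real n ^ h * ln (real n)"
    and m: "m \<ge> 2" "n0 ^ h \<le> m" "m < Suc M ^ h"
  defines "Y \<equiv> (real h * m / (c * ln m)) powr (1 / real h)"
  shows "(\<Sum>n = n0..M. exp (- a n / real m))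
    \<ge> Y * (gamma_aux h ((c * ln m / real h) powr (1 / real h)) - gamma_aux h (real n0 / Y))"
proof -
  define z where "z = real m powr (1 / real h)"
  define K where "K = nat \<lfloor>z\<rfloor>"
  have lnm: "ln (real m) > 0" using m by simp
  have z: "z > 0" "z ^ h = real m"
    using m assms(1) by (auto simp: z_def powr_powr simp flip: powr_realpow)
  have K: "real K \<le> z" "z < real (Suc K)"
    using z(1) unfolding K_def by linarith+
  have Y: "Y > 0" "Y ^ h = real h * m / (c * ln m)"
    using m assms(1,2) lnm by (auto simp: Y_def powr_powr simp flip: powr_realpow)
  have "real n0 ^ h \<le> z ^ h"
    unfolding z(2) of_nat_power[symmetric] of_nat_le_iff by fact
  then have "real n0 \<le> z"
    using power_mono_iff[of "real n0" z h] z(1) assms(1) by simp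
  with K have n0K: "n0 \<le> K" by linarith
  have "z ^ h < real (Suc M) ^ h"
    unfolding z(2) of_nat_power[symmetric] of_nat_less_iff by fact
  then have "z < real (Suc M)"
    by (rule power_less_imp_less_base) simp
  with K have KM: "K \<le> M" by linarith
  have zY: "z / Y = (c * ln m / real h) powr (1 / real h)"
    using assms(1,2) lnm m unfolding z_def Y_def by (simp flip: powr_divide)
  have "Y * (gamma_aux h (z / Y) - gamma_aux h (real n0 / Y))
    \<le> Y * (gamma_aux h (real (Suc K) / Y) - gamma_aux h (real n0 / Y))"
    using K Y z assms(1)
    by (intro mult_left_mono diff_right_mono gamma_aux_mono divide_right_mono) auto
  also have "\<dots> \<le> (\<Sum>n = n0..K. exp (- ((real n / Y) ^ h)))"
    using Y assms n0K by (intro sum_exp_power_ge) auto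
  also have "\<dots> \<le> (\<Sum>n = n0..K. exp (- a n / real m))"
  proof (intro sum_mono)
    fix n assume n: "n \<in> {n0..K}"
    then have n1: "real n \<ge> 1" "real n \<le> z" using assms(3) K by auto
    have "real h * ln (real n) \<le> real h * ln z"
      using n1 by (intro mult_left_mono) auto
    also have "\<dots> = ln (real m)"
      using z by (simp flip: ln_realpow)
    finally have "ln (real n) \<le> ln (real m) / real h"
      using assms(1) by (simp add: field_simps)
    then have "c * real n ^ h * ln (real n) \<le> c * real n ^ h * (ln (real m) / real h)"
      using assms(2) by (intro mult_left_mono) auto
    with a[of n] n have "a n \<le> c * real n ^ h * (ln (real m) / real h)" by simp
    then have "a n / real m \<le> c * real n ^ h * (ln (real m) / real h) / real m"
      by (rule divide_right_mono) simp
    also have "\<dots> = (real n / Y) ^ h"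
      using Y(2) by (simp add: power_divide)
    finally show "exp (- ((real n / Y) ^ h)) \<le> exp (- a n / real m)" by simp
  qed
  also have "\<dots> \<le> (\<Sum>n = n0..M. exp (- a n / real m))"
    using KM by (intro sum_mono2) auto
  finally show ?thesis by (simp add: zY)
qed

lemma sum_exp_sequence_asymp:
  fixes a :: "nat \<Rightarrow> real"
  assumes "h > 0" "c > 0" "n0 \<ge> 1"
    and a: "\<And>n. n \<ge> n0 \<Longrightarrow> a n \<le> c * real n ^ h * ln (real n)"
    and G: "G < Gamma (1 + 1 / real h)"
  shows "\<forall>\<^sub>F m::nat in at_top. \<forall>M. m < Suc M ^ h \<longrightarrow>
    (\<Sum>n = n0..M. exp (- a n / real m)) \<ge> G * (real h * m / (c * ln m)) powr (1 / real h)"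
proof -
  define \<epsilon> where "\<epsilon> = (Gamma (1 + 1 / real h) - G) / 2"
  have \<epsilon>: "\<epsilon> > 0" "Gamma (1 + 1 / real h) - \<epsilon> < Gamma (1 + 1 / real h)"
    and \<epsilon>2: "Gamma (1 + 1 / real h) - \<epsilon> - \<epsilon> = G"
    using G by (auto simp: \<epsilon>_def field_simps)
  define Y where "Y = (\<lambda>m::nat. (real h * real m / (c * ln (real m))) powr (1 / real h))"
  have h: "real h > 0" using assms(1) by simp
  have "filterlim (\<lambda>m::nat. (c * ln (real m) / real h) powr (1 / real h)) at_top at_top"
    using assms(2) h by real_asymp
  from filterlim_compose[OF gamma_aux_at_top[OF assms(1)] this]
  have 1: "\<forall>\<^sub>F m::nat in at_top. gamma_aux h ((c * ln (real m) / real h) powr (1 / real h)) > Gamma (1 + 1 / real h) - \<epsilon>"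
    by (rule order_tendstoD) (fact \<epsilon>)
  have n0: "real n0 > 0" using assms(3) by simp
  have "filterlim (\<lambda>m. real n0 / Y m) (at_right 0) at_top"
    unfolding Y_def using assms(2) h n0 by real_asymp
  then have 2: "\<forall>\<^sub>F m in at_top. gamma_aux h (real n0 / Y m) < \<epsilon>"
    using gamma_aux_at_0[OF assms(1) \<epsilon>(1)] by (auto simp: filterlim_iff)
  from 1 2 eventually_ge_at_top[of "2::nat"] eventually_ge_at_top[of "n0 ^ h"] show ?thesis
  proof eventually_elim
    case (elim m)
    show ?case
    proof (intro allI impI)
      fix M assume M: "m < Suc M ^ h"
      have "G * Y m \<le> Y m * (gamma_aux h ((c * ln m / real h) powr (1 / real h)) - gamma_aux h (real n0 / Y m))"
        using elim(1,2) \<epsilon>2 by (subst mult.commute, intro mult_left_mono) (auto simp: Y_def)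
      also have "\<dots> \<le> (\<Sum>n = n0..M. exp (- a n / real m))"
        unfolding Y_def by (rule sum_exp_sequence_ge[OF assms(1-3) a elim(3,4) M])
      finally show "G * (real h * m / (c * ln m)) powr (1 / real h) \<le> (\<Sum>n = n0..M. exp (- a n / real m))"
        by (simp add: Y_def)
    qed
  qed
qed

section \<open>The growth constant\<close>

lemma sum_inverse_mult_ln_ge:
  assumes "2 \<le> y1" "y1 \<le> y2"
  shows "(\<Sum>m = y1..<y2. 1 / (real m * ln (real m))) \<ge> ln (ln (real y2)) - ln (ln (real y1))"
  using assms(2)
proof (induction y2 rule: dec_induct)
  case (step n)
  have n: "real n \<ge> 2" using step(1) assms(1) by linarith
  obtain z where z: "real n < z" "z < real (Suc n)"
    "ln (ln (real (Suc n))) - ln (ln (real n)) = (real (Suc n) - real n) * (1 / (z * ln z))"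
    using MVT2[of "real n" "real (Suc n)" "\<lambda>x. ln (ln x)" "\<lambda>x. 1 / (x * ln x)"] n
    by (force intro!: derivative_eq_intros simp: field_simps)
  have "1 / (z * ln z) \<le> 1 / (real n * ln (real n))"
    using z n by (intro divide_left_mono mult_mono) auto
  with z(3) step.IH step.hyps show ?case by simp
qed simp

text \<open>The term with common entries is at most \<open>k\<^sup>2 / Q\<close> times the energy itself, because \<open>energy_power_le\<close>
  gives \<open>M Q energy\<^bsub>k-1\<^esub> \<le> energy\<^sub>k\<close> unless the energy is already below \<open>N\<^sup>2\<close>.\<close>
lemma energy_le:
  assumes "Bh_set (2 * k) A" "F \<subseteq> A" "finite F" "k > 0" "card F \<le> M" "M > 0" "Q > 0" "N = (M * Q) ^ k"
  shows "energy N F k * (1 - (real k)\<^sup>2 / real Q) \<le> (fact k)\<^sup>2 * (real N)\<^sup>2"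
proof (cases "energy N F k \<le> (real N)\<^sup>2")
  case True
  have "energy N F k * (1 - (real k)\<^sup>2 / real Q) \<le> energy N F k * 1"
    by (intro mult_left_mono energy_nonneg) auto
  also have "\<dots> \<le> 1 * (real N)\<^sup>2" using True by simp
  also have "\<dots> \<le> (fact k)\<^sup>2 * (real N)\<^sup>2"
    by (intro mult_right_mono) (auto simp: one_le_power)
  finally show ?thesis .
next
  case False
  obtain j where j: "k = Suc j" using assms(4) by (cases k) auto
  let ?e = "energy N F k" and ?d = "energy N F j"
  have Q: "real Q > 0" using assms(7) by simp
  have nonneg: "?e \<ge> 0" "?d \<ge> 0" by (rule energy_nonneg)+
  have "(real M * real Q * ?d) ^ Suc j = real N * ?d ^ Suc j"
    by (simp add: assms(8) j power_mult_distrib)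
  also have "\<dots> \<le> real N * (real N * ?e ^ j)"
    using energy_power_le[OF assms(3), of N j] by (intro mult_left_mono) (auto simp: j)
  also have "\<dots> = (real N)\<^sup>2 * ?e ^ j" by (simp add: power2_eq_square)
  also have "\<dots> \<le> ?e * ?e ^ j"
    using False nonneg by (intro mult_right_mono) auto
  finally have "(real M * real Q * ?d) ^ Suc j \<le> ?e ^ Suc j" by simp
  then have "real M * real Q * ?d \<le> ?e"
    by (rule power_le_imp_le_base) (rule nonneg)
  then have "real M * ?d \<le> ?e / real Q"
    using Q by (simp add: field_simps)
  moreover have "real (card F) * ?d \<le> real M * ?d"
    using assms(5) nonneg by (intro mult_right_mono) auto
  ultimately have "(real k)\<^sup>2 * (real (card F) * ?d) \<le> (real k)\<^sup>2 * (?e / real Q)"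
    by (intro mult_left_mono) auto
  moreover have "?e \<le> (fact k)\<^sup>2 * (real N)\<^sup>2 + (real k)\<^sup>2 * real (card F) * ?d"
    using energy_le_step[of j A F N] assms(1-3) by (simp only: j)
  ultimately show ?thesis by (simp add: algebra_simps)
qed

text \<open>The comparison of the upper and the lower bound at scale \<open>Q\<close>. All parameters are integer powers
  of \<open>Q\<close>: \<open>N = Q\<^bsup>kq\<^esup>\<close>, the variable \<open>m\<close> runs from \<open>N\<^bsup>1+1/q\<^esup>\<close> to \<open>N\<^bsup>2-2/q\<^esup>\<close>, and \<open>n\<close> runs up to \<open>M = Q\<^bsup>q-1\<^esup>\<close>. So
  \<open>M\<^sup>h\<close> is the end of the range of \<open>m\<close>, while \<open>M\<^sup>k = N / Q\<^sup>k\<close> is small against \<open>N\<close>. The condition \<open>q \<ge> 4\<close> makes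
  the range of \<open>m\<close> nonempty and the logarithm positive.\<close>
lemma energy_inequality:
  fixes a :: "nat \<Rightarrow> nat" and G c :: real
  assumes Bh: "Bh_set (2 * k) A" and k: "k > 0" and c: "c > 0" and n0: "n0 \<ge> 1"
    and a: "\<And>n. n \<ge> n0 \<Longrightarrow> a n \<in> A" "\<And>n. n \<ge> n0 \<Longrightarrow> a n > 0" "inj_on a {n0..}"
    and a_le: "\<And>n. n \<ge> n0 \<Longrightarrow> real (a n) \<le> c * real n ^ (2 * k) * ln (real n)"
    and G: "0 \<le> G" "G < Gamma (1 + 1 / real (2 * k))" and q: "q \<ge> 4"
  shows "\<forall>\<^sub>F Q::nat in at_top. G ^ (2 * k) * (real (2 * k) / c) * exp (- 2 / real Q ^ k)
    * ln (2 * (real q - 1) / (real q + 1)) * (1 - (real k)\<^sup>2 / real Q) \<le> pi * (fact k)\<^sup>2"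
proof -
  let ?h = "2 * k"
  have h: "?h > 0" using k by simp
  have "\<forall>\<^sub>F m::nat in at_top. \<forall>M. m < Suc M ^ ?h \<longrightarrow>
    (\<Sum>n = n0..M. exp (- real (a n) / real m)) \<ge> G * (real ?h * m / (c * ln m)) powr (1 / real ?h)"
    by (rule sum_exp_sequence_asymp[OF h c n0 a_le G(2)])
  then obtain m0 where m0: "\<And>m M. m \<ge> m0 \<Longrightarrow> m < Suc M ^ ?h \<Longrightarrow>
    (\<Sum>n = n0..M. exp (- real (a n) / real m)) \<ge> G * (real ?h * m / (c * ln m)) powr (1 / real ?h)"
    unfolding eventually_at_top_linorder by blast
  show ?thesis
    using eventually_ge_at_top[of 2] eventually_ge_at_top[of m0] eventually_ge_at_top[of "k\<^sup>2"]
  proof eventually_elim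
    case (elim Q)
    define N M y1 y2 where "N = Q ^ (k * q)" and "M = Q ^ (q - 1)"
      and "y1 = Q ^ (k * (q + 1))" and "y2 = Q ^ (2 * k * (q - 1))"
    define F where "F = a ` {n0..M}"
    define I where "I = {y1..<y2}"
    define v where "v = (\<lambda>m::nat. 1 / sqrt (real m * ln (real m)))"
    define B where "B = G ^ k * sqrt (real ?h / c)"
    define e where "e = exp (- 1 / real Q ^ k)"
    define S where "S = (\<Sum>m\<in>I. 1 / (real m * ln (real m)))"
    have Q: "real Q > 1" using elim(1) by simp
    have N: "N > 0" "N = (M * Q) ^ k"
    proof -
      have "Q ^ (q - 1) * Q = Q ^ q"
        using q by (cases q) auto
      then show "N = (M * Q) ^ k"
        by (simp add: N_def M_def power_mult[symmetric] mult.commute)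
    qed (use elim(1) in \<open>simp add: N_def\<close>)
    have "Q ^ 1 \<le> y1"
      unfolding y1_def using k elim(1) by (intro power_increasing) auto
    with elim have y1: "y1 \<ge> 2" "y1 \<ge> m0" by auto
    have y12: "y1 \<le> y2"
    proof -
      have "q + 1 \<le> 2 * (q - 1)" using q by linarith
      then have "k * (q + 1) \<le> k * (2 * (q - 1))" by (rule mult_le_mono2)
      then show ?thesis
        unfolding y1_def y2_def using elim(1) by (intro power_increasing) (auto simp: mult_ac)
    qed
    have Ipos: "real m \<ge> 2" "ln (real m) > 0" "m \<ge> m0" "m < Suc M ^ ?h" if "m \<in> I" for m
    proof -
      from that y1 have "m \<ge> 2" "m \<ge> m0" by (auto simp: I_def)
      moreover have "y2 = M ^ ?h"
        by (simp add: y2_def M_def power_mult[symmetric] mult_ac)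
      then have "m < M ^ ?h" using that by (simp add: I_def)
      then have "m < Suc M ^ ?h"
        by (rule less_le_trans) (intro power_mono, auto)
      ultimately show "real m \<ge> 2" "ln (real m) > 0" "m \<ge> m0" "m < Suc M ^ ?h" by auto
    qed
    have F: "finite F" "F \<subseteq> A" "0 \<notin> F" "card F \<le> M"
      unfolding F_def using a(1,2) n0 card_image_le[of "{n0..M}" a] by fastforce+
    have B: "B \<ge> 0" "B\<^sup>2 = G ^ (2 * k) * (real (2 * k) / c)"
      using G(1) c by (auto simp: B_def power_mult_distrib power_mult[symmetric] mult.commute)
    have v2: "(\<Sum>m\<in>I. (v m)\<^sup>2) = S"
      unfolding S_def v_def using Ipos by (intro sum.cong refl) (force simp: power_divide)
    \<comment> \<open>The choice of \<open>v\<close> makes both the individual terms and \<open>(v m)\<^sup>2\<close> multiples of \<open>1 / (m ln m)\<close>.\<close>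
    have term_ge: "B * e * (1 / (real m * ln (real m)))
      \<le> v m / real m * exp (- real N / real m) * (\<Sum>b\<in>F. exp (- real b / real m)) ^ k" if m: "m \<in> I" for m
    proof -
      note mp = Ipos[OF m]
      define x l where "x = sqrt (real m)" and "l = sqrt (ln (real m))"
      have xl: "x > 0" "l > 0" "x\<^sup>2 = real m" "l\<^sup>2 = ln (real m)"
        using mp by (auto simp: x_def l_def)
      have "(\<Sum>b\<in>F. exp (- real b / real m)) = (\<Sum>n = n0..M. exp (- real (a n) / real m))"
        unfolding F_def using inj_on_subset[OF a(3), of "{n0..M}"] by (subst sum.reindex) auto
      then have ge: "(\<Sum>b\<in>F. exp (- real b / real m)) \<ge> G * (real ?h * m / (c * ln m)) powr (1 / real ?h)"
        using m0[OF mp(3,4)] by simp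
      have "((real ?h * m / (c * ln m)) powr (1 / real ?h)) ^ k = (real ?h * m / (c * ln m)) powr (1 / 2)"
        using k c mp by (simp add: powr_powr flip: powr_realpow)
      also have "\<dots> = sqrt (real ?h / c) * (x / l)"
        using c mp by (simp add: powr_half_sqrt x_def l_def real_sqrt_mult real_sqrt_divide)
      finally have "B * (x / l) = (G * (real ?h * m / (c * ln m)) powr (1 / real ?h)) ^ k"
        by (simp add: power_mult_distrib B_def)
      also have "\<dots> \<le> (\<Sum>b\<in>F. exp (- real b / real m)) ^ k"
        using G(1) by (intro power_mono ge) auto
      finally have p: "B * (x / l) \<le> (\<Sum>b\<in>F. exp (- real b / real m)) ^ k" .
      have "real N / real m \<le> real N / real y1"
        using m y1 by (intro divide_left_mono) (auto simp: I_def)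
      also have "\<dots> = 1 / real Q ^ k"
        using Q by (simp add: N_def y1_def distrib_left power_add)
      finally have E: "e \<le> exp (- real N / real m)" by (simp add: e_def)
      have vm: "v m = 1 / (x * l)"
        by (simp add: v_def x_def l_def real_sqrt_mult)
      have "B * e * (1 / (x\<^sup>2 * l\<^sup>2)) = v m / x\<^sup>2 * e * (B * (x / l))"
        using xl(1,2) by (simp add: vm power2_eq_square mult_ac)
      then have "B * e * (1 / (real m * ln (real m))) = v m / real m * e * (B * (x / l))"
        by (simp only: xl(3,4))
      also have "\<dots> \<le> v m / real m * exp (- real N / real m) * (\<Sum>b\<in>F. exp (- real b / real m)) ^ k"
        using p E B xl mp by (intro mult_mono) (auto simp: v_def e_def)
      finally show ?thesis .
    qed
    define L where "L = (\<Sum>m\<in>I. v m / real m * exp (- real N / real m) * (\<Sum>b\<in>F. exp (- real b / real m)) ^ k)"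
    have "B * e * S \<le> L"
      unfolding S_def L_def sum_distrib_left by (intro sum_mono term_ge)
    then have NL: "real N * (B * e * S) \<le> real N * L"
      by (rule mult_left_mono) simp
    have S: "S \<ge> ln (2 * (real q - 1) / (real q + 1))"
    proof -
      have lnQ: "ln (real Q) > 0" and kq: "real k > 0" "real q > 1" using Q k q by auto
      have "ln (ln (real y2)) - ln (ln (real y1)) = ln (ln (real y2) / ln (real y1))"
        using y1 y12 by (intro ln_divide_pos[symmetric]) auto
      also have "ln (real y2) / ln (real y1) = 2 * (real q - 1) / (real q + 1)"
      proof -
        have "ln (real y2) = (real k * ln (real Q)) * (2 * (real q - 1))"
          using Q q by (simp add: y2_def ln_realpow of_nat_diff)
        moreover have "ln (real y1) = (real k * ln (real Q)) * (real q + 1)"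
          using Q by (simp add: y1_def ln_realpow algebra_simps)
        ultimately show ?thesis using lnQ kq by simp
      qed
      finally show ?thesis
        using sum_inverse_mult_ln_ge[OF y1(1) y12] by (simp add: S_def I_def)
    qed
    have lnq: "ln (2 * (real q - 1) / (real q + 1)) > 0"
      using q by (intro ln_gt_zero) (simp add: field_simps)
    with S have Spos: "S > 0" by linarith
    have "(real N * (B * e * S))\<^sup>2 \<le> (real N * L)\<^sup>2"
      using B Spos NL by (intro power_mono) (auto simp: e_def)
    also have "\<dots> \<le> energy N F k * (pi * (\<Sum>m\<in>I. (v m)\<^sup>2))"
      unfolding L_def using F k y1 Ipos
      by (intro exp_sums_le_energy) (auto simp: I_def v_def)
    finally have "S * ((real N)\<^sup>2 * B\<^sup>2 * e\<^sup>2 * S) \<le> S * (energy N F k * pi)"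
      unfolding v2 by (simp add: power_mult_distrib power2_eq_square mult_ac)
    then have "(real N)\<^sup>2 * B\<^sup>2 * e\<^sup>2 * S \<le> energy N F k * pi"
      using Spos by simp
    moreover have r: "1 - (real k)\<^sup>2 / real Q \<ge> 0"
      using elim(1,3) by (simp add: of_nat_power[symmetric] del: of_nat_power)
    ultimately have "(real N)\<^sup>2 * B\<^sup>2 * e\<^sup>2 * S * (1 - (real k)\<^sup>2 / real Q)
      \<le> energy N F k * pi * (1 - (real k)\<^sup>2 / real Q)"
      by (rule mult_right_mono)
    also have "\<dots> = pi * (energy N F k * (1 - (real k)\<^sup>2 / real Q))" by simp
    also have "\<dots> \<le> pi * ((fact k)\<^sup>2 * (real N)\<^sup>2)"
      using elim(1) by (intro mult_left_mono energy_le[OF Bh F(2,1) k F(4) _ _ N(2)]) (auto simp: M_def)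
    finally have "(real N)\<^sup>2 * (B\<^sup>2 * e\<^sup>2 * S * (1 - (real k)\<^sup>2 / real Q)) \<le> (real N)\<^sup>2 * (pi * (fact k)\<^sup>2)"
      by (simp add: mult_ac)
    then have "B\<^sup>2 * e\<^sup>2 * S * (1 - (real k)\<^sup>2 / real Q) \<le> pi * (fact k)\<^sup>2"
      using N(1) by simp
    moreover have "B\<^sup>2 * e\<^sup>2 * ln (2 * (real q - 1) / (real q + 1)) * (1 - (real k)\<^sup>2 / real Q)
      \<le> B\<^sup>2 * e\<^sup>2 * S * (1 - (real k)\<^sup>2 / real Q)"
      using S r by (intro mult_right_mono mult_left_mono) auto
    moreover have "e\<^sup>2 = exp (- 2 / real Q ^ k)"
      by (simp add: e_def power2_eq_square mult_exp_exp)
    ultimately show ?case unfolding B(2) by simp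
  qed
qed

text \<open>The limits \<open>Q \<rightarrow> \<infinity>\<close>, \<open>q \<rightarrow> \<infinity>\<close> and \<open>G \<rightarrow> \<Gamma>(1 + 1/h)\<close> are taken in this order.\<close>
lemma growth_constant_ge:
  fixes a :: "nat \<Rightarrow> nat" and c :: real
  assumes Bh: "Bh_set (2 * k) A" and k: "k > 0" and c: "c > 0" and n0: "n0 \<ge> 1"
    and a: "\<And>n. n \<ge> n0 \<Longrightarrow> a n \<in> A" "\<And>n. n \<ge> n0 \<Longrightarrow> a n > 0" "inj_on a {n0..}"
    and a_le: "\<And>n. n \<ge> n0 \<Longrightarrow> real (a n) \<le> c * real n ^ (2 * k) * ln (real n)"
  shows "ln 2 / pi * (real (2 * k) * Gamma (1 + 1 / real (2 * k)) ^ (2 * k) / (fact k)\<^sup>2) \<le> c"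
proof -
  let ?\<Gamma> = "Gamma (1 + 1 / real (2 * k))"
  have \<Gamma>: "?\<Gamma> > 0" by (intro Gamma_real_pos) (simp add: add_pos_nonneg)
  have 1: "G ^ (2 * k) * (real (2 * k) / c) * ln (2 * (real q - 1) / (real q + 1)) \<le> pi * (fact k)\<^sup>2"
    if G: "0 \<le> G" "G < ?\<Gamma>" and q: "q \<ge> 4" for G q
  proof (rule tendsto_upperbound)
    have "((\<lambda>Q::nat. exp (- 2 / real Q ^ k)) \<longlongrightarrow> 1) at_top"
      using k by real_asymp
    moreover have "((\<lambda>Q::nat. 1 - (real k)\<^sup>2 / real Q) \<longlongrightarrow> 1) at_top"
      by real_asymp
    ultimately have "((\<lambda>Q::nat. G ^ (2 * k) * (real (2 * k) / c) * exp (- 2 / real Q ^ k)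
      * ln (2 * (real q - 1) / (real q + 1)) * (1 - (real k)\<^sup>2 / real Q))
      \<longlongrightarrow> G ^ (2 * k) * (real (2 * k) / c) * 1 * ln (2 * (real q - 1) / (real q + 1)) * 1) at_top"
      by (intro tendsto_mult tendsto_const)
    then show "((\<lambda>Q::nat. G ^ (2 * k) * (real (2 * k) / c) * exp (- 2 / real Q ^ k)
      * ln (2 * (real q - 1) / (real q + 1)) * (1 - (real k)\<^sup>2 / real Q))
      \<longlongrightarrow> G ^ (2 * k) * (real (2 * k) / c) * ln (2 * (real q - 1) / (real q + 1))) at_top"
      by simp
  qed (use energy_inequality[OF assms G q] in auto)
  have 2: "G ^ (2 * k) * (real (2 * k) / c) * ln 2 \<le> pi * (fact k)\<^sup>2" if G: "0 \<le> G" "G < ?\<Gamma>" for G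
  proof (rule tendsto_upperbound)
    have "((\<lambda>q::nat. ln (2 * (real q - 1) / (real q + 1))) \<longlongrightarrow> ln 2) at_top" by real_asymp
    then show "((\<lambda>q::nat. G ^ (2 * k) * (real (2 * k) / c) * ln (2 * (real q - 1) / (real q + 1)))
      \<longlongrightarrow> G ^ (2 * k) * (real (2 * k) / c) * ln 2) at_top"
      by (rule tendsto_mult_left)
    show "\<forall>\<^sub>F q::nat in at_top. G ^ (2 * k) * (real (2 * k) / c) * ln (2 * (real q - 1) / (real q + 1))
      \<le> pi * (fact k)\<^sup>2"
      using eventually_ge_at_top[of 4] by eventually_elim (use 1[OF G] in auto)
  qed simp
  have "?\<Gamma> ^ (2 * k) * (real (2 * k) / c) * ln 2 \<le> pi * (fact k)\<^sup>2"
  proof (rule tendsto_upperbound)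
    show "((\<lambda>G. G ^ (2 * k) * (real (2 * k) / c) * ln 2) \<longlongrightarrow> ?\<Gamma> ^ (2 * k) * (real (2 * k) / c) * ln 2) (at_left ?\<Gamma>)"
      by (intro tendsto_intros)
    show "\<forall>\<^sub>F G in at_left ?\<Gamma>. G ^ (2 * k) * (real (2 * k) / c) * ln 2 \<le> pi * (fact k)\<^sup>2"
      using eventually_at_left_real[OF \<Gamma>] by eventually_elim (use 2 in auto)
  qed simp
  then show ?thesis
    using c by (simp add: field_simps)
qed

theorem corollary2:
  fixes h :: nat and A :: "nat set"
  assumes "h > 0" and "even h"
    and "infinite A" and "Bh_set h A"
  shows "limsup (\<lambda>n. ereal (real (nth_elem A n) / (real n ^ h * ln (real n))))
    \<ge> ereal (ln 2 / pi * (real h * Gamma (1 + 1 / real h) ^ h / Gamma (1 + real h / 2) ^ 2))"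
proof (rule ccontr)
  let ?f = "\<lambda>n. real (nth_elem A n) / (real n ^ h * ln (real n))"
  let ?L = "ln 2 / pi * (real h * Gamma (1 + 1 / real h) ^ h / Gamma (1 + real h / 2) ^ 2)"
  assume "\<not> limsup (\<lambda>n. ereal (?f n)) \<ge> ereal ?L"
  then have "limsup (\<lambda>n. ereal (?f n)) < ereal ?L"
    by (simp only: not_le)
  from ereal_dense2[OF this] obtain c where
    "limsup (\<lambda>n. ereal (?f n)) < ereal c" "ereal c < ereal ?L"
    by blast
  then have c: "limsup (\<lambda>n. ereal (?f n)) < ereal c" "c < ?L"
    by (simp_all only: less_ereal.simps)
  obtain k where hk: "h = 2 * k" using assms(2) by (elim evenE)
  with assms(1) have k: "k > 0" by simp
  from Limsup_lessD[OF c(1)] obtain n1 where n1: "\<And>n. n \<ge> n1 \<Longrightarrow> ?f n < c"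
    by (auto simp: eventually_at_top_linorder)
  \<comment> \<open>From the second element on, the elements and the logarithms of their indices are positive.\<close>
  define n0 where "n0 = max n1 2"
  have n0: "n0 \<ge> 1" "n0 \<ge> n1" "n0 \<ge> 2" by (auto simp: n0_def)
  have c0: "c > 0"
  proof -
    have "ln (real n0) \<ge> 0" using n0(1) by simp
    then have "?f n0 \<ge> 0" by simp
    with n1[OF n0(2)] show ?thesis by linarith
  qed
  have "ln 2 / pi * (real (2 * k) * Gamma (1 + 1 / real (2 * k)) ^ (2 * k) / (fact k)\<^sup>2) \<le> c"
  proof (rule growth_constant_ge[OF _ k c0 n0(1), of A "nth_elem A"])
    show "Bh_set (2 * k) A" using assms(4) by (simp add: hk)
    fix n assume n: "n \<ge> n0"
    show "nth_elem A n \<in> A"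
      using assms(3) by (simp add: nth_elem_def enumerate_in_set)
    have "n - 1 \<le> nth_elem A n"
      using le_enumerate[OF assms(3)] by (simp add: nth_elem_def)
    with n n0 show "nth_elem A n > 0" by linarith
    have "ln (real n) > 0" using n n0 by simp
    then have "real n ^ h * ln (real n) > 0" using n n0 by simp
    with n1[of n] n n0 show "real (nth_elem A n) \<le> c * real n ^ (2 * k) * ln (real n)"
      by (simp add: pos_divide_less_eq hk mult.assoc less_imp_le)
  next
    show "inj_on (nth_elem A) {n0..}"
    proof (rule inj_onI)
      fix x y assume xy: "x \<in> {n0..}" "y \<in> {n0..}" "nth_elem A x = nth_elem A y"
      then have "enumerate A (x - 1) \<le> enumerate A (y - 1)" "enumerate A (y - 1) \<le> enumerate A (x - 1)"
        by (simp_all add: nth_elem_def)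
      then have "x - 1 = y - 1"
        using assms(3) by (metis enumerate_mono_le_iff order_antisym)
      with xy n0(1) show "x = y" by auto
    qed
  qed
  moreover have "Gamma (1 + real h / 2) = fact k"
    using Gamma_fact[of k, where 'a = real] by (simp add: hk)
  ultimately show False using c(2) by (simp add: hk)
qed

end
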